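(* Let $X$ be a connected compact metric space that is not a single point, and let $f:X\to X$ be continuous. Then the following are equivalent: (1) $f$ is chain recurrent. (2) $f$ is chain transitive. (3) $f$ is totally chain transitive. (4) $f$ is chain mixing.
   Context: Write $d$ for the metric of $X$. An $\varepsilon$-chain for a map $g:X\to X$ of length $n\ge1$ from $x$ to $y$ is a sequence $(x=x_0,x_1,\dots,x_n=y)$ with $d(g(x_{i-1}),x_i)\le\varepsilon$ for $i=1,\dots,n$. A map $g$ is chain recurrent if for every $x\in X$ and every $\varepsilon>0$ there is an $\varepsilon$-chain from $x$ to itself. It is chain transitive if for every $x,y\in X$ and every $\varepsilon>0$ there is an $\varepsilon$-chain from $x$ to $y$. The map $f$ is totally chain transitive if the iterate $f^n$ is chain transitive for all $n\ge1$. The map $f$ is $\varepsilon$-chain mixing if there is $N>0$ such that for any $x,y\in X$ and any $n\ge N$ there is an $\varepsilon$-chain for $f$ from $x$ to $y$ of length exactly $n$; $f$ is chain mixing if it is $\varepsilon$-chain mixing for every $\varepsilon>0$. *)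

theory Defs
  imports "HOL-Analysis.Analysis"
begin

(* The space is a subset X of a metric-space type with the induced metric; a self-map of X is a
   function g on the ambient type whose values outside X are irrelevant.  Only the values
   c 0, ..., c n of a sequence c matter for a chain of length n. *)

definition is_chain ::
  "'a::metric_space set \<Rightarrow> ('a \<Rightarrow> 'a) \<Rightarrow> real \<Rightarrow> nat \<Rightarrow> 'a \<Rightarrow> 'a \<Rightarrow> (nat \<Rightarrow> 'a) \<Rightarrow> bool" where
  "is_chain X g \<epsilon> n x y c \<longleftrightarrow>
     n \<ge> 1 \<and> c 0 = x \<and> c n = y \<and> (\<forall>i\<le>n. c i \<in> X) \<and>
     (\<forall>i\<in>{1..n}. dist (g (c (i - 1))) (c i) \<le> \<epsilon>)"

definition chain_recurrent :: "'a::metric_space set \<Rightarrow> ('a \<Rightarrow> 'a) \<Rightarrow> bool" where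
  "chain_recurrent X g \<longleftrightarrow> (\<forall>x\<in>X. \<forall>\<epsilon>>0. \<exists>n c. is_chain X g \<epsilon> n x x c)"

definition chain_transitive :: "'a::metric_space set \<Rightarrow> ('a \<Rightarrow> 'a) \<Rightarrow> bool" where
  "chain_transitive X g \<longleftrightarrow> (\<forall>x\<in>X. \<forall>y\<in>X. \<forall>\<epsilon>>0. \<exists>n c. is_chain X g \<epsilon> n x y c)"

definition totally_chain_transitive :: "'a::metric_space set \<Rightarrow> ('a \<Rightarrow> 'a) \<Rightarrow> bool" where
  "totally_chain_transitive X g \<longleftrightarrow> (\<forall>n\<ge>1. chain_transitive X (g ^^ n))"

definition eps_chain_mixing :: "'a::metric_space set \<Rightarrow> ('a \<Rightarrow> 'a) \<Rightarrow> real \<Rightarrow> bool" where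
  "eps_chain_mixing X g \<epsilon> \<longleftrightarrow>
     (\<exists>N>0. \<forall>x\<in>X. \<forall>y\<in>X. \<forall>n\<ge>N. \<exists>c. is_chain X g \<epsilon> n x y c)"

definition chain_mixing :: "'a::metric_space set \<Rightarrow> ('a \<Rightarrow> 'a) \<Rightarrow> bool" where
  "chain_mixing X g \<longleftrightarrow> (\<forall>\<epsilon>>0. eps_chain_mixing X g \<epsilon>)"

end

theory Submission
  imports Defs
begin

text \<open>
  The substantial implication is that chain recurrence implies chain mixing; the way back from
  mixing through total chain transitivity and chain transitivity to recurrence is formal, apart from
  the fact that fine \<open>f\<close>-chains of length \<open>n\<close> shadow \<open>f ^^ n\<close>.

  Chain recurrence gives a loop at every point, but the lengths of the loops vary.  Uniform
  continuity of \<open>f\<close> makes chains robust: both ends of a chain may be moved by a small \<open>\<delta>\<close> at the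
  cost of a slightly larger error.  Hence the loops at the points of a finite \<open>\<delta>\<close>-net, each repeated
  until all have a common length \<open>M\<close>, yield chains of length exactly \<open>M\<close> between \<^emph>\<open>any\<close> two points
  that are close to each other (\<open>chain_recurrent_nearby_uniform_length\<close>).  A compact connected space
  can be crossed between any two points by exactly \<open>n\<close> small jumps, for every large \<open>n\<close>
  (\<open>connected_compact_joined_by_small_jumps\<close>), so any two points are joined by chains of length
  \<open>n * M\<close> for every large \<open>n\<close>.  Lengths that are not divisible by \<open>M\<close> come for free: follow the true
  orbit of the starting point for the first \<open>r < M\<close> steps and join its end to the target by a chain
  whose length is a multiple of \<open>M\<close>.
\<close>

section \<open>Chains as powers of a relation\<close>

lemma relpow_mono_subset: "R \<subseteq> S \<Longrightarrow> R ^^ n \<subseteq> S ^^ n" for R S :: "('a \<times> 'a) set"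
  by (induction n) (auto intro!: relcomp_mono)

lemma relpow_mult: "R ^^ (m * n) = (R ^^ m) ^^ n" for R :: "('a \<times> 'a) set"
  by (induction n) (simp_all add: add.commute[of m] relpow_add)

lemma relpow_loop_multiple:
  assumes "(x, x) \<in> R ^^ m" "m dvd n"
  shows "(x, x) \<in> R ^^ n"
proof -
  have "(x, x) \<in> (R ^^ m) ^^ k" for k
    using assms(1) by (induction k) auto
  with assms(2) show ?thesis
    by (auto simp: relpow_mult elim!: dvdE)
qed

text \<open>With single steps as a relation, concatenating, repeating and splitting chains is the algebra
  of relational powers.\<close>

definition chain_step :: "'a::metric_space set \<Rightarrow> ('a \<Rightarrow> 'a) \<Rightarrow> real \<Rightarrow> ('a \<times> 'a) set" where
  "chain_step X g \<epsilon> = {(u, v). u \<in> X \<and> v \<in> X \<and> dist (g u) v \<le> \<epsilon>}"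

lemma chain_step_power_iff:
  "(\<exists>c. is_chain X g \<epsilon> n x y c) \<longleftrightarrow> n \<ge> 1 \<and> (x, y) \<in> chain_step X g \<epsilon> ^^ n"
proof (cases "n \<ge> 1")
  case True
  have "is_chain X g \<epsilon> n x y c \<longleftrightarrow>
      c 0 = x \<and> c n = y \<and> (\<forall>i<n. (c i, c (Suc i)) \<in> chain_step X g \<epsilon>)" for c
  proof -
    have "(\<forall>i\<le>n. c i \<in> X) \<longleftrightarrow> (\<forall>i<n. c i \<in> X \<and> c (Suc i) \<in> X)"
    proof
      assume *: "\<forall>i<n. c i \<in> X \<and> c (Suc i) \<in> X"
      show "\<forall>i\<le>n. c i \<in> X"
      proof (intro allI impI)
        fix i assume "i \<le> n"
        then show "c i \<in> X"
          using * True by (cases i) auto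
      qed
    qed auto
    moreover have "(\<forall>i\<in>{1..n}. dist (g (c (i - 1))) (c i) \<le> \<epsilon>) \<longleftrightarrow>
        (\<forall>i<n. dist (g (c i)) (c (Suc i)) \<le> \<epsilon>)"
    proof
      assume *: "\<forall>i<n. dist (g (c i)) (c (Suc i)) \<le> \<epsilon>"
      show "\<forall>i\<in>{1..n}. dist (g (c (i - 1))) (c i) \<le> \<epsilon>"
      proof
        fix i assume "i \<in> {1..n}"
        then show "dist (g (c (i - 1))) (c i) \<le> \<epsilon>"
          using * by (cases i) auto
      qed
    qed force
    ultimately show ?thesis
      using True by (auto simp: is_chain_def chain_step_def)
  qed
  then show ?thesis
    using True by (simp add: relpow_fun_conv)
qed (simp add: is_chain_def)

lemma chain_step_mono: "\<epsilon> \<le> \<epsilon>' \<Longrightarrow> chain_step X g \<epsilon> \<subseteq> chain_step X g \<epsilon>'"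
  by (auto simp: chain_step_def)

lemma chain_step_power_in_space:
  assumes "(x, y) \<in> chain_step X g \<epsilon> ^^ n" "x \<in> X"
  shows "y \<in> X"
  using assms by (cases n) (auto simp: chain_step_def)

lemma funpow_in_space: "g ` X \<subseteq> X \<Longrightarrow> x \<in> X \<Longrightarrow> (g ^^ n) x \<in> X"
  by (induction n) auto

lemma orbit_chain:
  assumes "g ` X \<subseteq> X" "x \<in> X" "0 \<le> \<epsilon>"
  shows "(x, (g ^^ n) x) \<in> chain_step X g \<epsilon> ^^ n"
proof (induction n)
  case (Suc n)
  have "((g ^^ n) x, (g ^^ Suc n) x) \<in> chain_step X g \<epsilon>"
    using assms funpow_in_space[OF assms(1,2), of n] funpow_in_space[OF assms(1,2), of "Suc n"]
    by (simp add: chain_step_def)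
  with Suc show ?case by auto
qed simp

text \<open>A step only sees the image of its first point, so what matters at the start of a chain is how
  far the image moves.\<close>

lemma chain_perturb_ends:
  assumes chain: "(a, b) \<in> chain_step X g \<epsilon> ^^ n" and "n \<ge> 1"
    and start: "x \<in> X" "dist (g x) (g a) \<le> \<eta>"
    and "end": "y \<in> X" "dist b y \<le> \<eta>" and "0 \<le> \<eta>"
  shows "(x, y) \<in> chain_step X g (\<epsilon> + 2 * \<eta>) ^^ n"
proof -
  obtain m where n: "n = Suc m"
    using \<open>n \<ge> 1\<close> by (cases n) auto
  obtain c where c: "(a, c) \<in> chain_step X g \<epsilon>" "(c, b) \<in> chain_step X g \<epsilon> ^^ m"
    using chain relpow_Suc_D2 unfolding n by metis
  have xc: "(x, c) \<in> chain_step X g (\<epsilon> + \<eta>)"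
    using c(1) start dist_triangle[of "g x" c "g a"] by (auto simp: chain_step_def)
  have "chain_step X g \<epsilon> ^^ m \<subseteq> chain_step X g (\<epsilon> + \<eta>) ^^ m"
    using \<open>0 \<le> \<eta>\<close> by (intro relpow_mono_subset chain_step_mono) simp
  with c(2) xc have "(x, b) \<in> chain_step X g (\<epsilon> + \<eta>) ^^ Suc m"
    by (blast intro: relpow_Suc_I2)
  then obtain d where d: "(x, d) \<in> chain_step X g (\<epsilon> + \<eta>) ^^ m" "(d, b) \<in> chain_step X g (\<epsilon> + \<eta>)"
    by auto
  have dy: "(d, y) \<in> chain_step X g (\<epsilon> + 2 * \<eta>)"
    using d(2) "end" dist_triangle[of "g d" y b] by (auto simp: chain_step_def)
  have "chain_step X g (\<epsilon> + \<eta>) ^^ m \<subseteq> chain_step X g (\<epsilon> + 2 * \<eta>) ^^ m"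
    using \<open>0 \<le> \<eta>\<close> by (intro relpow_mono_subset chain_step_mono) simp
  with d(1) dy show ?thesis
    unfolding n by (blast intro: relpow_Suc_I)
qed

section \<open>Crossing a compact connected space by small jumps\<close>

lemma compact_finite_net:
  fixes X :: "'a::metric_space set"
  assumes "compact X" "\<delta> > 0"
  obtains F where "finite F" "F \<subseteq> X" "\<And>x. x \<in> X \<Longrightarrow> \<exists>a\<in>F. dist x a < \<delta>"
proof -
  have "X \<subseteq> (\<Union>a\<in>X. ball a \<delta>)"
    using assms(2) by auto
  then obtain F where F: "finite F" "F \<subseteq> X" "X \<subseteq> (\<Union>a\<in>F. ball a \<delta>)"
    using compactE_image[OF assms(1), of X "\<lambda>a. ball a \<delta>"] by (metis open_ball)
  show ?thesis
  proof (rule that[OF F(1,2)])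
    fix x assume "x \<in> X"
    then show "\<exists>a\<in>F. dist x a < \<delta>"
      using F(3) by (fastforce simp: dist_commute)
  qed
qed

text \<open>Being joined by small jumps is an open equivalence relation, so connectedness leaves a single
  class.  Jumps may be trivial, so every larger number of jumps will also do, and a finite net
  bounds the number needed uniformly.\<close>

lemma connected_compact_joined_by_small_jumps:
  fixes X :: "'a::metric_space set"
  assumes "compact X" "connected X" "\<delta> > 0"
  defines "J \<equiv> {(u, v). u \<in> X \<and> v \<in> X \<and> dist u v < \<delta>}"
  shows "\<forall>\<^sub>F n in sequentially. X \<times> X \<subseteq> J ^^ n"
proof -
  have refl: "(x, x) \<in> J" if "x \<in> X" for x
    using that \<open>\<delta> > 0\<close> by (simp add: J_def)
  have joined: "(x, y) \<in> J\<^sup>*" if "x \<in> X" "y \<in> X" for x y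
  proof (rule connected_equivalence_relation[OF \<open>connected X\<close> that])
    have "sym J"
      by (auto simp: J_def dist_commute intro: symI)
    then show "(v, u) \<in> J\<^sup>*" if "(u, v) \<in> J\<^sup>*" for u v
      using that by (meson sym_rtrancl symD)
    show "\<exists>T. openin (top_of_set X) T \<and> u \<in> T \<and> (\<forall>v\<in>T. (u, v) \<in> J\<^sup>*)" if "u \<in> X" for u
      using that \<open>\<delta> > 0\<close> by (intro exI[of _ "X \<inter> ball u \<delta>"]) (auto simp: J_def)
  qed auto
  have pointwise: "\<forall>\<^sub>F n in sequentially. (x, y) \<in> J ^^ n" if xy: "x \<in> X" "y \<in> X" for x y
  proof -
    obtain k where k: "(x, y) \<in> J ^^ k"
      using joined[OF xy] rtrancl_power by blast
    have "(x, y) \<in> J ^^ n" if "k \<le> n" for n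
    proof -
      have "(y, y) \<in> J ^^ (n - k)"
        using refl[OF xy(2)] by (simp add: relpow_loop_multiple[where x = y and m = 1])
      with k have "(x, y) \<in> J ^^ (k + (n - k))"
        by (rule relpow_trans)
      with that show ?thesis by simp
    qed
    then show ?thesis
      unfolding eventually_sequentially by blast
  qed
  obtain F where F: "finite F" "F \<subseteq> X" "\<And>x. x \<in> X \<Longrightarrow> \<exists>a\<in>F. dist x a < \<delta>"
    using compact_finite_net[OF assms(1) \<open>\<delta> > 0\<close>] by blast
  have "\<forall>\<^sub>F n in sequentially. \<forall>p\<in>F \<times> F. p \<in> J ^^ n"
    using F(1,2) pointwise by (intro eventually_ball_finite) auto
  then obtain K where K: "\<And>n p. n \<ge> K \<Longrightarrow> p \<in> F \<times> F \<Longrightarrow> p \<in> J ^^ n"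
    unfolding eventually_sequentially by blast
  have "X \<times> X \<subseteq> J ^^ n" if "n \<ge> K + 2" for n
  proof clarify
    fix x y assume xy: "x \<in> X" "y \<in> X"
    define m where "m = n - 2"
    have n: "n = Suc (Suc m)" "m \<ge> K"
      using that by (auto simp: m_def)
    obtain a b where ab: "a \<in> F" "dist x a < \<delta>" "b \<in> F" "dist y b < \<delta>"
      using F(3) xy by meson
    have "(x, a) \<in> J" "(b, y) \<in> J"
      using ab xy F(2) by (auto simp: J_def dist_commute)
    moreover have "(a, b) \<in> J ^^ m"
      using K n(2) ab by auto
    ultimately show "(x, y) \<in> J ^^ n"
      unfolding n(1) by (intro relpow_Suc_I[of x b] relpow_Suc_I2[of x a])
  qed
  then show ?thesis
    unfolding eventually_sequentially by blast
qed

section \<open>From chain recurrence to chain mixing\<close>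

text \<open>The loops at the points of a finite net, repeated to a common length, still lead from anywhere
  near their base point to anywhere near it.\<close>

lemma chain_recurrent_nearby_uniform_length:
  assumes "compact X" "continuous_on X f" "chain_recurrent X f" "\<epsilon> > 0"
  obtains M \<delta> where "M \<ge> 1" "\<delta> > 0"
    "\<And>x y. x \<in> X \<Longrightarrow> y \<in> X \<Longrightarrow> dist x y < \<delta> \<Longrightarrow> (x, y) \<in> chain_step X f \<epsilon> ^^ M"
proof -
  define \<eta> where "\<eta> = \<epsilon> / 3"
  have "\<eta> > 0" using \<open>\<epsilon> > 0\<close> by (simp add: \<eta>_def)
  have "uniformly_continuous_on X f"
    using assms(1,2) by (rule compact_uniformly_continuous[rotated])
  then obtain \<delta>' where \<delta>': "\<delta>' > 0"
      "\<And>u v. u \<in> X \<Longrightarrow> v \<in> X \<Longrightarrow> dist u v < \<delta>' \<Longrightarrow> dist (f u) (f v) < \<eta>"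
    using \<open>\<eta> > 0\<close> unfolding uniformly_continuous_on_def by (metis dist_commute)
  define \<delta> where "\<delta> = min \<delta>' \<eta>"
  have "\<delta> > 0" using \<delta>'(1) \<open>\<eta> > 0\<close> by (simp add: \<delta>_def)
  \<comment> \<open>Half of \<open>\<delta>\<close>, so that two points at distance below \<open>\<delta> / 2\<close> both lie within \<open>\<delta>\<close> of one net
    point.\<close>
  obtain F where F: "finite F" "F \<subseteq> X" "\<And>x. x \<in> X \<Longrightarrow> \<exists>a\<in>F. dist x a < \<delta> / 2"
    using compact_finite_net[OF assms(1), of "\<delta> / 2"] \<open>\<delta> > 0\<close> by auto
  have "\<forall>a\<in>F. \<exists>n. n \<ge> 1 \<and> (a, a) \<in> chain_step X f \<eta> ^^ n"
    using assms(3) F(2) \<open>\<eta> > 0\<close> unfolding chain_recurrent_def chain_step_power_iff by blast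
  then obtain l where l: "\<And>a. a \<in> F \<Longrightarrow> l a \<ge> 1 \<and> (a, a) \<in> chain_step X f \<eta> ^^ l a"
    by metis
  define M where "M = (\<Prod>a\<in>F. l a)"
  have "M \<ge> 1"
    unfolding M_def using l by (intro prod_ge_1) auto
  show ?thesis
  proof (rule that[OF \<open>M \<ge> 1\<close>, of "\<delta> / 2"])
    fix x y assume xy: "x \<in> X" "y \<in> X" "dist x y < \<delta> / 2"
    obtain a where a: "a \<in> F" "dist x a < \<delta> / 2"
      using F(3) xy(1) by blast
    have "(a, a) \<in> chain_step X f \<eta> ^^ M"
    proof (rule relpow_loop_multiple)
      show "(a, a) \<in> chain_step X f \<eta> ^^ l a"
        using l[OF a(1)] by blast
      show "l a dvd M"
        using a(1) F(1) by (auto simp: M_def intro: dvd_prodI)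
    qed
    moreover have "dist (f x) (f a) \<le> \<eta>"
      using a F(2) xy(1) \<open>\<delta> > 0\<close> by (intro less_imp_le \<delta>'(2)) (auto simp: \<delta>_def)
    moreover have "dist a y \<le> \<eta>"
    proof -
      have "dist a y < \<delta>"
        using a(2) xy(3) dist_triangle[of a y x] by (simp add: dist_commute)
      then show ?thesis by (simp add: \<delta>_def)
    qed
    ultimately have "(x, y) \<in> chain_step X f (\<eta> + 2 * \<eta>) ^^ M"
      using \<open>M \<ge> 1\<close> xy \<open>\<eta> > 0\<close> by (intro chain_perturb_ends) auto
    then show "(x, y) \<in> chain_step X f \<epsilon> ^^ M"
      by (simp add: \<eta>_def)
  qed (use \<open>\<delta> > 0\<close> in simp)
qed

lemma chain_recurrent_imp_chain_mixing:
  assumes "compact X" "connected X" "continuous_on X f" "f ` X \<subseteq> X" "chain_recurrent X f"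
  shows "chain_mixing X f"
  unfolding chain_mixing_def
proof (intro allI impI)
  fix \<epsilon> :: real assume "\<epsilon> > 0"
  obtain M \<delta> where M: "M \<ge> 1" "\<delta> > 0"
      and near: "\<And>x y. x \<in> X \<Longrightarrow> y \<in> X \<Longrightarrow> dist x y < \<delta> \<Longrightarrow> (x, y) \<in> chain_step X f \<epsilon> ^^ M"
    using chain_recurrent_nearby_uniform_length[OF assms(1,3,5) \<open>\<epsilon> > 0\<close>] by metis
  obtain K where K: "\<And>k. k \<ge> K \<Longrightarrow>
      X \<times> X \<subseteq> {(u, v). u \<in> X \<and> v \<in> X \<and> dist u v < \<delta>} ^^ k"
    using connected_compact_joined_by_small_jumps[OF assms(1,2) M(2)]
    unfolding eventually_sequentially by blast
  have multiple: "(x, y) \<in> chain_step X f \<epsilon> ^^ (M * k)" if "x \<in> X" "y \<in> X" "k \<ge> K" for x y k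
  proof -
    have "{(u, v). u \<in> X \<and> v \<in> X \<and> dist u v < \<delta>} \<subseteq> chain_step X f \<epsilon> ^^ M"
      using near by auto
    then have "{(u, v). u \<in> X \<and> v \<in> X \<and> dist u v < \<delta>} ^^ k \<subseteq> (chain_step X f \<epsilon> ^^ M) ^^ k"
      by (rule relpow_mono_subset)
    then show ?thesis
      using K[OF that(3)] that(1,2) by (auto simp: relpow_mult)
  qed
  \<comment> \<open>The successor only serves to make the bound positive when \<open>K = 0\<close>.\<close>
  have "(x, y) \<in> chain_step X f \<epsilon> ^^ n" if xy: "x \<in> X" "y \<in> X" and n: "n \<ge> Suc (M * K)" for x y n
  proof -
    define r where "r = n mod M"
    have "n div M \<ge> K"
      using n M(1) by (simp add: less_eq_div_iff_mult_less_eq mult.commute)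
    then have "((f ^^ r) x, y) \<in> chain_step X f \<epsilon> ^^ (M * (n div M))"
      using xy funpow_in_space[OF assms(4)] by (intro multiple) auto
    with orbit_chain[OF assms(4) xy(1), of \<epsilon> r] \<open>\<epsilon> > 0\<close>
    have "(x, y) \<in> chain_step X f \<epsilon> ^^ (r + M * (n div M))"
      by (auto intro: relpow_trans[of x "(f ^^ r) x"])
    then show ?thesis
      by (simp add: r_def)
  qed
  then show "eps_chain_mixing X f \<epsilon>"
    unfolding eps_chain_mixing_def chain_step_power_iff
    by (intro exI[of _ "Suc (M * K)"]) auto
qed

section \<open>From chain mixing to total chain transitivity\<close>

lemma fine_chain_shadows_iterate:
  fixes X :: "'a::metric_space set"
  assumes "uniformly_continuous_on X f" "f ` X \<subseteq> X" "\<epsilon> > 0"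
  shows "\<exists>\<delta>>0. \<forall>x\<in>X. \<forall>y. (x, y) \<in> chain_step X f \<delta> ^^ n \<longrightarrow> dist ((f ^^ n) x) y \<le> \<epsilon>"
  using assms(3)
proof (induction n arbitrary: \<epsilon>)
  case 0
  then show ?case by (intro exI[of _ 1]) auto
next
  case (Suc n)
  obtain \<rho> where \<rho>: "\<rho> > 0"
      "\<And>u v. u \<in> X \<Longrightarrow> v \<in> X \<Longrightarrow> dist u v < \<rho> \<Longrightarrow> dist (f u) (f v) < \<epsilon> / 2"
    using assms(1) Suc.prems unfolding uniformly_continuous_on_def
    by (metis dist_commute half_gt_zero)
  obtain \<delta> where \<delta>: "\<delta> > 0"
      "\<And>x y. x \<in> X \<Longrightarrow> (x, y) \<in> chain_step X f \<delta> ^^ n \<Longrightarrow> dist ((f ^^ n) x) y \<le> \<rho> / 2"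
    using Suc.IH[of "\<rho> / 2"] \<rho>(1) by auto
  define \<delta>' where "\<delta>' = min \<delta> (\<epsilon> / 2)"
  have "dist ((f ^^ Suc n) x) y \<le> \<epsilon>"
    if x: "x \<in> X" and chain: "(x, y) \<in> chain_step X f \<delta>' ^^ Suc n" for x y
  proof -
    obtain z where z: "(x, z) \<in> chain_step X f \<delta>' ^^ n" "(z, y) \<in> chain_step X f \<delta>'"
      using chain by auto
    have "chain_step X f \<delta>' ^^ n \<subseteq> chain_step X f \<delta> ^^ n"
      by (intro relpow_mono_subset chain_step_mono) (simp add: \<delta>'_def)
    then have "dist ((f ^^ n) x) z < \<rho>"
      using \<delta>(2)[OF x, of z] z(1) \<rho>(1) by fastforce
    then have "dist (f ((f ^^ n) x)) (f z) < \<epsilon> / 2"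
      using z(2) funpow_in_space[OF assms(2) x] by (intro \<rho>(2)) (auto simp: chain_step_def)
    moreover have "dist (f z) y \<le> \<epsilon> / 2"
      using z(2) by (auto simp: chain_step_def \<delta>'_def)
    ultimately show ?thesis
      using dist_triangle[of "f ((f ^^ n) x)" y "f z"] by simp
  qed
  moreover have "\<delta>' > 0"
    using \<delta>(1) Suc.prems by (simp add: \<delta>'_def)
  ultimately show ?case by blast
qed

text \<open>Every \<open>n\<close>-th point of a fine \<open>f\<close>-chain is a chain for \<open>f ^^ n\<close>, and mixing supplies
  \<open>f\<close>-chains whose length is divisible by \<open>n\<close>.\<close>

lemma chain_mixing_imp_totally_chain_transitive:
  assumes "compact X" "continuous_on X f" "f ` X \<subseteq> X" "chain_mixing X f"
  shows "totally_chain_transitive X f"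
  unfolding totally_chain_transitive_def chain_transitive_def chain_step_power_iff
proof (intro allI impI ballI)
  fix n :: nat and x y and \<epsilon> :: real
  assume n: "1 \<le> n" and xy: "x \<in> X" "y \<in> X" and "\<epsilon> > 0"
  have "uniformly_continuous_on X f"
    using assms(1,2) by (rule compact_uniformly_continuous[rotated])
  then obtain \<delta> where \<delta>: "\<delta> > 0"
      "\<And>u v. u \<in> X \<Longrightarrow> (u, v) \<in> chain_step X f \<delta> ^^ n \<Longrightarrow> dist ((f ^^ n) u) v \<le> \<epsilon>"
    using fine_chain_shadows_iterate[OF _ assms(3) \<open>\<epsilon> > 0\<close>, of n] by blast
  have sub: "chain_step X f \<delta> ^^ n \<subseteq> chain_step X (f ^^ n) \<epsilon>"
  proof clarify
    fix u v assume uv: "(u, v) \<in> chain_step X f \<delta> ^^ n"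
    then have "u \<in> X"
      using n relpow_Suc_D2[of u v "n - 1" "chain_step X f \<delta>"] by (auto simp: chain_step_def)
    with uv \<delta>(2) show "(u, v) \<in> chain_step X (f ^^ n) \<epsilon>"
      using chain_step_power_in_space[OF uv] by (simp add: chain_step_def)
  qed
  have "eps_chain_mixing X f \<delta>"
    using assms(4) \<delta>(1) by (simp add: chain_mixing_def)
  then obtain N where N: "N > 0"
      "\<forall>x\<in>X. \<forall>y\<in>X. \<forall>k\<ge>N. k \<ge> 1 \<and> (x, y) \<in> chain_step X f \<delta> ^^ k"
    unfolding eps_chain_mixing_def chain_step_power_iff by (elim exE conjE)
  have chain: "(x, y) \<in> chain_step X f \<delta> ^^ (n * N)"
    using n xy by (simp add: N(2))
  have "(x, y) \<in> chain_step X (f ^^ n) \<epsilon> ^^ N"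
    using relpow_mono_subset[OF sub, of N] chain unfolding relpow_mult by blast
  then show "\<exists>k\<ge>1. (x, y) \<in> chain_step X (f ^^ n) \<epsilon> ^^ k"
    using N(1) by (intro exI[of _ N]) auto
qed

theorem corollary14:
  fixes X :: "'a::metric_space set" and f :: "'a \<Rightarrow> 'a"
  assumes "compact X" and "connected X" and "\<nexists>p. X = {p}"
    and "continuous_on X f" and "f ` X \<subseteq> X"
  shows "(chain_recurrent X f \<longleftrightarrow> chain_transitive X f) \<and>
         (chain_transitive X f \<longleftrightarrow> totally_chain_transitive X f) \<and>
         (totally_chain_transitive X f \<longleftrightarrow> chain_mixing X f)"
proof -
  have "chain_mixing X f" if "chain_recurrent X f"
    using chain_recurrent_imp_chain_mixing[OF assms(1,2,4,5) that] .
  moreover have "totally_chain_transitive X f" if "chain_mixing X f"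
    using chain_mixing_imp_totally_chain_transitive[OF assms(1,4,5) that] .
  moreover have "chain_transitive X f" if "totally_chain_transitive X f"
    using that[unfolded totally_chain_transitive_def, rule_format, of 1] by simp
  moreover have "chain_recurrent X f" if "chain_transitive X f"
    using that by (auto simp: chain_transitive_def chain_recurrent_def)
  ultimately show ?thesis by blast
qed

end
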